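(* Let $H=(V,\mathcal{E})$ be a hypergraph. Then every partial sub-hypergraph $H'$ of $H$ satisfies $\nu^*(H')=\tau^*(H')$ if and only if $H$ has no partial sub-hypergraph isomorphic to the tail hypergraph.
   Context: A hypergraph is a pair $H=(V,\mathcal{E})$ where $V$ is a set (possibly infinite) and $\mathcal{E}$ is a set of subsets of $V$ (edges, possibly infinite). A fractional matching is $f:\mathcal{E}\to\mathbb{R}_{\ge0}$ with $\sum_{E\ni v}f(E)\le1$ for every $v\in V$; its size is $|f|=\sum_{E\in\mathcal{E}}f(E)$. A fractional cover is $g:V\to\mathbb{R}_{\ge0}$ with $\sum_{v\in E}g(v)\ge1$ for every $E\in\mathcal{E}$; its size is $|g|=\sum_{v\in V}g(v)$. (Sums of nonnegative terms are suprema of finite partial sums and may be $\infty$.) $\nu^*(H)=\sup\{|f|\}$ over fractional matchings and $\tau^*(H)=\inf\{|g|\}$ over fractional covers; both may be infinite. A partial sub-hypergraph of $H$ is $H'=(V',\mathcal{E}')$ with $V'\subseteq V$ and $\mathcal{E}'=\{E\cap V':E\in\mathcal{E}_0\}$ for some $\mathcal{E}_0\subseteq\mathcal{E}$. The tail hypergraph is $(\mathbb{N},\{E_j:j\in\mathbb{N}\})$ with $E_j=\{i\in\mathbb{N}:i\ge j\}$. Isomorphism of hypergraphs is a bijection of vertex sets inducing a bijection of edge sets. *)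

theory Defs
  imports Complex_Main "HOL-Library.Extended_Nonnegative_Real"
begin

definition nnsum :: "('b \<Rightarrow> real) \<Rightarrow> 'b set \<Rightarrow> ennreal" where
  "nnsum f A = (SUP F \<in> {F. finite F \<and> F \<subseteq> A}. ennreal (sum f F))"

definition hypergraph :: "'a set \<Rightarrow> 'a set set \<Rightarrow> bool" where
  "hypergraph V Es \<longleftrightarrow> (\<forall>E\<in>Es. E \<subseteq> V)"

definition frac_matching :: "'a set \<Rightarrow> 'a set set \<Rightarrow> ('a set \<Rightarrow> real) \<Rightarrow> bool" where
  "frac_matching V Es f \<longleftrightarrow> (\<forall>E\<in>Es. f E \<ge> 0) \<and>
     (\<forall>v\<in>V. nnsum f {E\<in>Es. v \<in> E} \<le> 1)"

definition frac_cover :: "'a set \<Rightarrow> 'a set set \<Rightarrow> ('a \<Rightarrow> real) \<Rightarrow> bool" where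
  "frac_cover V Es g \<longleftrightarrow> (\<forall>v\<in>V. g v \<ge> 0) \<and>
     (\<forall>E\<in>Es. nnsum g E \<ge> 1)"

definition nu_star :: "'a set \<Rightarrow> 'a set set \<Rightarrow> ennreal" where
  "nu_star V Es = (SUP f \<in> {f. frac_matching V Es f}. nnsum f Es)"

definition tau_star :: "'a set \<Rightarrow> 'a set set \<Rightarrow> ennreal" where
  "tau_star V Es = (INF g \<in> {g. frac_cover V Es g}. nnsum g V)"

definition partial_sub_hypergraph ::
  "'a set \<Rightarrow> 'a set set \<Rightarrow> 'a set \<Rightarrow> 'a set set \<Rightarrow> bool" where
  "partial_sub_hypergraph V' Es' V Es \<longleftrightarrow>
     V' \<subseteq> V \<and> (\<exists>Es0 \<subseteq> Es. Es' = (\<lambda>E. E \<inter> V') ` Es0)"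

definition tail_edge :: "nat \<Rightarrow> nat set" where
  "tail_edge j = {i. i \<ge> j}"

definition tail_hypergraph_edges :: "nat set set" where
  "tail_hypergraph_edges = range tail_edge"

definition hg_isomorphic ::
  "'a set \<Rightarrow> 'a set set \<Rightarrow> 'b set \<Rightarrow> 'b set set \<Rightarrow> bool" where
  "hg_isomorphic V Es W Fs \<longleftrightarrow>
     (\<exists>\<phi>. bij_betw \<phi> V W \<and> bij_betw (\<lambda>E. \<phi> ` E) Es Fs)"

end

theory Submission
  imports
    Defs
    "HOL-Library.Diagonal_Subsequence"
    "HOL-Library.Infinite_Set"
    "HOL-Library.Nat_Bijection"
begin

text \<open>
  A tail hypergraph amounts to vertices \<open>a l\<close> and edges \<open>C j\<close> with
  \<open>a l \<in> C j \<longleftrightarrow> j \<le> l\<close>. It has \<open>\<nu>\<^sup>* \<le> 1\<close>, as finitely many tails have a common vertex, but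
  no cover of finite size, as the tails of a convergent series vanish.

  Conversely, let \<open>\<nu>\<^sup>* < N < M < \<tau>\<^sup>*\<close>. Then every finitely supported probability on the edges
  gives mass at least \<open>1/N\<close> to the edges through some vertex, and every finitely supported
  probability on the vertices gives mass at most \<open>1/M\<close> to some edge. By an approximate minimax
  theorem there are finitely supported averages \<open>avg n\<close> of edges, each of them small on a finite set
  of vertices realising all types over the earlier edges. Ptak's combinatorial lemma gives an infinite
  set of indices on which all the averages are eventually large along one sequence of vertices \<open>v\<close>,
  which may be taken to converge on all edges involved. A second application of Ptak's lemma, to
  the edges containing almost all \<open>v i\<close>, produces an infinite set of indices \<open>i\<close> and edges \<open>C n\<close> such
  that \<open>v i \<notin> C n\<close> for large \<open>n\<close>, while \<open>v i \<in> C n\<close> for large \<open>i\<close>; thinning out yields a tail.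
\<close>

section \<open>Diagonal subsequences\<close>

text \<open>For a single \<open>k\<close> either infinitely many terms satisfy \<open>P k\<close>,
  and one passes to those, or almost all terms fail it. Both alternatives survive further thinning,
  so a diagonal sequence settles all \<open>k\<close> at once.\<close>

lemma subseq_eventually_decides:
  fixes P :: "nat \<Rightarrow> nat \<Rightarrow> bool"
  shows "\<exists>r. strict_mono r \<and>
    (\<forall>k. (\<forall>\<^sub>F n in sequentially. P k (r n)) \<or> (\<forall>\<^sub>F n in sequentially. \<not> P k (r n)))"
proof -
  let ?Q = "\<lambda>k s. (\<forall>\<^sub>F n in sequentially. P k (s n)) \<or> (\<forall>\<^sub>F n in sequentially. \<not> P k (s n))"
  have "\<exists>r'. strict_mono r' \<and> ?Q k (s \<circ> r')" for k and s :: "nat \<Rightarrow> nat"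
  proof (cases "infinite {n. P k (s n)}")
    case True
    then have "strict_mono (enumerate {n. P k (s n)})" "\<And>n. P k (s (enumerate {n. P k (s n)} n))"
      using enumerate_in_set[of "{n. P k (s n)}"] by (auto simp: strict_mono_enumerate)
    then show ?thesis
      by (intro exI[of _ "enumerate {n. P k (s n)}"]) simp
  next
    case False
    then have "\<forall>\<^sub>F n in sequentially. \<not> P k (s n)"
      by (simp add: cofinite_eq_sequentially[symmetric] eventually_cofinite)
    then show ?thesis
      by (intro exI[of _ id]) (simp add: strict_mono_id)
  qed
  then interpret subseqs ?Q
    by unfold_locales auto
  have holds: "?Q k (diagseq \<circ> (+) (Suc k))" for k
  proof (rule diagseq_holds)
    fix s r :: "nat \<Rightarrow> nat" and n
    assume "strict_mono r" "?Q n s"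
    then show "?Q n (s \<circ> r)"
      by (auto dest: eventually_subseq)
  qed
  have "?Q k diagseq" for k
    using holds[of k, unfolded comp_def add.commute[of "Suc k"]]
      eventually_sequentially_seg[of "\<lambda>n. P k (diagseq n)" "Suc k"]
      eventually_sequentially_seg[of "\<lambda>n. \<not> P k (diagseq n)" "Suc k"]
    by blast
  then show ?thesis
    using subseq_diagseq by blast
qed

section \<open>Ptak's combinatorial lemma\<close>

text \<open>The bound \<open>\<epsilon>\<close> and the start \<open>m\<close> of the admissible
  supports are left free, so that a subfamily may count as large with a smaller
  \<open>\<epsilon>\<close> and a later \<open>m\<close>.\<close>

definition ptak_large :: "nat set set \<Rightarrow> bool" where
  "ptak_large \<S> \<longleftrightarrow> (\<exists>\<epsilon>>0. \<exists>m. \<forall>B w. finite B \<and> B \<subseteq> {m..} \<and> (\<forall>j\<in>B. 0 \<le> w j) \<and> sum w B = (1::real)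
     \<longrightarrow> (\<exists>S\<in>\<S>. \<epsilon> \<le> sum w (B \<inter> S)))"

lemma ptak_largeI:
  assumes "\<epsilon> > 0"
    and "\<And>B w. finite B \<Longrightarrow> B \<subseteq> {m..} \<Longrightarrow> (\<And>j. j \<in> B \<Longrightarrow> 0 \<le> w j) \<Longrightarrow> sum w B = (1::real)
       \<Longrightarrow> \<exists>S\<in>\<S>. \<epsilon> \<le> sum w (B \<inter> S)"
  shows "ptak_large \<S>"
  unfolding ptak_large_def using assms by (intro exI[of _ \<epsilon>] conjI exI[of _ m]) auto

lemma ptak_large_nonempty: "ptak_large \<S> \<Longrightarrow> \<S> \<noteq> {}"
proof -
  assume "ptak_large \<S>"
  then obtain \<epsilon> m where "\<And>B w. finite B \<and> B \<subseteq> {m..} \<and> (\<forall>j\<in>B. 0 \<le> w j) \<and> sum w B = (1::real)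
     \<longrightarrow> (\<exists>S\<in>\<S>. \<epsilon> \<le> sum w (B \<inter> S))" "\<epsilon> > 0"
    unfolding ptak_large_def by blast
  from this(1)[of "{m}" "\<lambda>_. 1"] show ?thesis by auto
qed

text \<open>Otherwise one can choose successively probabilities that are small on all members meeting the
  supports of their predecessors. A member then has large mass for at most one of them, hence small
  mass for their average.\<close>

lemma ptak_large_step:
  assumes "ptak_large \<S>"
  shows "\<exists>A. finite A \<and> A \<subseteq> {m..} \<and> ptak_large {S \<in> \<S>. S \<inter> A \<noteq> {}}"
proof (rule ccontr)
  define L where "L A = ptak_large {S \<in> \<S>. S \<inter> A \<noteq> {}}" for A
  assume "\<not> ?thesis"
  then have no: "\<not> (\<exists>A. finite A \<and> A \<subseteq> {m..} \<and> L A)"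
    unfolding L_def .
  obtain \<epsilon> m0 where \<epsilon>: "\<epsilon> > 0"
    and large: "\<And>B w. finite B \<Longrightarrow> B \<subseteq> {m0..} \<Longrightarrow> (\<And>j. j \<in> B \<Longrightarrow> 0 \<le> w j) \<Longrightarrow> sum w B = (1::real)
       \<Longrightarrow> (\<exists>S\<in>\<S>. \<epsilon> \<le> sum w (B \<inter> S))"
    using assms unfolding ptak_large_def by meson
  define M where "M = max m m0"
  have ex: "\<exists>B w. finite B \<and> B \<subseteq> {M..} \<and> (\<forall>j\<in>B. 0 \<le> w j) \<and> sum w B = (1::real) \<and>
      (\<forall>S\<in>\<S>. S \<inter> A \<noteq> {} \<longrightarrow> sum w (B \<inter> S) < \<epsilon> / 2)" if "finite A" "A \<subseteq> {M..}" for A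
  proof -
    have "A \<subseteq> {m..}"
      using that(2) by (rule order_trans) (simp add: M_def)
    then have not_large: "\<not> L A"
      using no that(1) by (metis (no_types))
    show ?thesis
    proof (rule ccontr)
      assume no_w: "\<not> ?thesis"
      have "L A"
        unfolding L_def
      proof (rule ptak_largeI[of "\<epsilon> / 2" M])
        fix B and w :: "nat \<Rightarrow> real"
        assume "finite B" "B \<subseteq> {M..}" "\<And>j. j \<in> B \<Longrightarrow> 0 \<le> w j" "sum w B = 1"
        then have "\<not> (\<forall>S\<in>\<S>. S \<inter> A \<noteq> {} \<longrightarrow> sum w (B \<inter> S) < \<epsilon> / 2)"
          using no_w[unfolded not_ex, rule_format, of B w] by simp
        then show "\<exists>S\<in>{S \<in> \<S>. S \<inter> A \<noteq> {}}. \<epsilon> / 2 \<le> sum w (B \<inter> S)"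
          by (auto simp: not_less)
      qed (use \<epsilon> in simp)
      then show False
        using not_large by contradiction
    qed
  qed
  obtain Bf wf where Bf: "\<And>A. finite A \<Longrightarrow> A \<subseteq> {M..} \<Longrightarrow> finite (Bf A) \<and> Bf A \<subseteq> {M..} \<and>
      (\<forall>j\<in>Bf A. 0 \<le> wf A j) \<and> sum (wf A) (Bf A) = (1::real) \<and>
      (\<forall>S\<in>\<S>. S \<inter> A \<noteq> {} \<longrightarrow> sum (wf A) (Bf A \<inter> S) < \<epsilon> / 2)"
    using ex by metis
  define A where "A = rec_nat {} (\<lambda>_ X. X \<union> Bf X)"
  have A0: "A 0 = {}" and AS: "A (Suc n) = A n \<union> Bf (A n)" for n
    by (simp_all add: A_def)
  have A: "finite (A n) \<and> A n \<subseteq> {M..}" for n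
    by (induction n) (use Bf in \<open>auto simp: A0 AS\<close>)
  note B = Bf[OF A[THEN conjunct1] A[THEN conjunct2]]
  have B_nonneg: "0 \<le> wf (A n) j" if "j \<in> Bf (A n)" for n j
    using B[of n] that by blast
  have B_sum: "sum (wf (A n)) (Bf (A n)) = 1" and B_fin: "finite (Bf (A n))" for n
    using B[of n] by blast+
  have B_small: "sum (wf (A n)) (Bf (A n) \<inter> S) < \<epsilon> / 2" if "S \<in> \<S>" "S \<inter> A n \<noteq> {}" for n S
    using B[of n] that by blast
  have A_mono: "mono A"
    by (rule incseq_SucI) (auto simp: AS)
  obtain k :: nat where k: "2 / \<epsilon> < real k" using reals_Archimedean2 by blast
  then have k0: "real k > 0" using \<epsilon> by (smt (verit) divide_pos_pos)
  \<comment> \<open>The supports \<open>Bf (A r)\<close> may overlap; weights at common points are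
    added, so \<open>w\<close> is still the average of \<open>k\<close> probabilities.\<close>
  define w where "w j = (\<Sum>r<k. if j \<in> Bf (A r) then wf (A r) j else 0) / k" for j
  have sub: "Bf (A r) \<subseteq> A k" if "r < k" for r
    using monoD[OF A_mono, of "Suc r" k] that by (auto simp: AS)
  have sum_w: "sum w (A k \<inter> S) = (\<Sum>r<k. sum (wf (A r)) (Bf (A r) \<inter> S)) / k" for S
  proof -
    have "sum w (A k \<inter> S) = (\<Sum>r<k. \<Sum>j\<in>A k \<inter> S. if j \<in> Bf (A r) then wf (A r) j else 0) / k"
      unfolding w_def sum_divide_distrib[symmetric] by (subst sum.swap) simp
    also have "(\<Sum>j\<in>A k \<inter> S. if j \<in> Bf (A r) then wf (A r) j else 0) = sum (wf (A r)) (Bf (A r) \<inter> S)"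
      if "r < k" for r
      using sub[OF that] A[of k] by (subst sum.inter_restrict[symmetric]) (auto intro!: sum.cong)
    then have "(\<Sum>r<k. \<Sum>j\<in>A k \<inter> S. if j \<in> Bf (A r) then wf (A r) j else 0)
        = (\<Sum>r<k. sum (wf (A r)) (Bf (A r) \<inter> S))"
      by (rule sum.cong[OF refl]) simp
    finally show ?thesis .
  qed
  have "\<exists>S\<in>\<S>. \<epsilon> \<le> sum w (A k \<inter> S)"
  proof (rule large)
    show "finite (A k)" "A k \<subseteq> {m0..}" using A[of k] by (auto simp: M_def)
    show "0 \<le> w j" for j
      by (auto simp: w_def intro!: divide_nonneg_nonneg sum_nonneg B_nonneg)
    show "sum w (A k) = 1"
      using sum_w[of UNIV] k0 by (simp add: B_sum)
  qed
  then obtain S where S: "S \<in> \<S>" "\<epsilon> \<le> sum w (A k \<inter> S)" by blast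
  define \<delta> where "\<delta> = \<epsilon> / 2"
  define u where "u n = sum (wf (A n)) (Bf (A n) \<inter> S)" for n
  \<comment> \<open>\<open>S\<close> contributes nothing while it avoids the sets \<open>A\<close>,
    at most 1 at the single stage where it first meets one, and less than \<open>\<delta>\<close> at
    each later stage.\<close>
  have "(\<Sum>r<n. u r) \<le> (if S \<inter> A n = {} then 0 else 1) + real n * \<delta>" for n
  proof (induction n)
    case (Suc n)
    have le1: "u n \<le> 1"
      using sum_mono2[of "Bf (A n)" "Bf (A n) \<inter> S" "wf (A n)"] B_fin B_sum B_nonneg
      by (simp add: u_def)
    have "\<delta> > 0" using \<epsilon> by (simp add: \<delta>_def)
    consider "S \<inter> A n \<noteq> {}" | "S \<inter> A (Suc n) = {}" | "S \<inter> A n = {}" "S \<inter> A (Suc n) \<noteq> {}"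
      by blast
    then show ?case
    proof cases
      case 1
      then have "u n < \<delta>" "S \<inter> A (Suc n) \<noteq> {}"
        using B_small S(1) by (auto simp: AS u_def \<delta>_def)
      then show ?thesis using Suc 1 by (simp add: distrib_right)
    next
      case 2
      then have "Bf (A n) \<inter> S = {}" "S \<inter> A n = {}" by (auto simp: AS)
      then show ?thesis using Suc 2 \<open>\<delta> > 0\<close> by (simp add: distrib_right u_def)
    next
      case 3
      then show ?thesis using Suc le1 \<open>\<delta> > 0\<close> by (simp add: distrib_right)
    qed
  qed simp
  from this[of k] have "(\<Sum>r<k. u r) \<le> 1 + real k * \<delta>"
    by (auto split: if_splits)
  moreover have "\<epsilon> * real k \<le> (\<Sum>r<k. u r)"
    using S(2) k0 by (simp add: sum_w u_def pos_le_divide_eq)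
  moreover have "2 < \<epsilon> * real k"
    using k \<epsilon> by (simp add: pos_divide_less_eq mult.commute)
  moreover have "\<epsilon> * real k = 2 * (real k * \<delta>)"
    by (simp add: \<delta>_def)
  ultimately show False by linarith
qed

text \<open>Iterating \<open>ptak_large_step\<close> gives decreasing large families
  \<open>F n\<close> such that all members of \<open>F (Suc n)\<close> meet one finite set beyond
  \<open>n\<close>. A pointwise convergent subsequence of members \<open>s n\<close> of
  \<open>F n\<close> has a limit that must meet each of these finite sets, and so is
  infinite.\<close>

lemma ptak:
  fixes \<S> :: "nat set set" and \<epsilon> :: real
  assumes "\<epsilon> > 0"
    and "\<And>B w. finite B \<Longrightarrow> (\<And>j. j \<in> B \<Longrightarrow> 0 \<le> w j) \<Longrightarrow> sum w B = 1 \<Longrightarrow> \<exists>S\<in>\<S>. \<epsilon> \<le> sum w (B \<inter> S)"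
  shows "\<exists>J s. infinite J \<and> (\<forall>n. s n \<in> \<S>) \<and> (\<forall>j\<in>J. \<forall>\<^sub>F n in sequentially. j \<in> s n)"
proof -
  have "ptak_large \<S>"
    by (rule ptak_largeI[of \<epsilon> 0]) (use assms in auto)
  define f where "f m \<T> =
    (SOME A. finite A \<and> A \<subseteq> {m..} \<and> ptak_large {S \<in> \<T>. S \<inter> A \<noteq> {}})" for m \<T>
  have f: "finite (f m \<T>) \<and> f m \<T> \<subseteq> {m..} \<and> ptak_large {S \<in> \<T>. S \<inter> f m \<T> \<noteq> {}}"
    if "ptak_large \<T>" for m \<T>
    unfolding f_def by (rule someI_ex) (rule ptak_large_step[OF that])
  define F where "F = rec_nat \<S> (\<lambda>m \<T>. {S \<in> \<T>. S \<inter> f m \<T> \<noteq> {}})"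
  have F0: "F 0 = \<S>" and FS: "F (Suc n) = {S \<in> F n. S \<inter> f n (F n) \<noteq> {}}" for n
    by (simp_all add: F_def)
  have large: "ptak_large (F n)" for n
    by (induction n) (use \<open>ptak_large \<S>\<close> f in \<open>auto simp: F0 FS\<close>)
  have F_anti: "F n \<subseteq> F m" if "m \<le> n" for m n
    by (rule lift_Suc_antimono_le[OF _ that]) (auto simp: FS)
  have "\<exists>S. S \<in> F n" for n
    using ptak_large_nonempty[OF large] by blast
  then obtain s where s: "\<And>n. s n \<in> F n" by metis
  obtain r where r: "strict_mono r"
    "\<And>k. (\<forall>\<^sub>F n in sequentially. k \<in> s (r n)) \<or> (\<forall>\<^sub>F n in sequentially. k \<notin> s (r n))"
    using subseq_eventually_decides[of "\<lambda>k n. k \<in> s n"] by blast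
  define J where "J = {k. \<forall>\<^sub>F n in sequentially. k \<in> s (r n)}"
  \<comment> \<open>Otherwise the finite set \<open>f q (F q)\<close>, whose points are all at least
    \<open>q\<close>, would eventually be disjoint from \<open>s (r n)\<close>, although every
    member of \<open>F (Suc q)\<close> meets it.\<close>
  have "\<exists>k\<in>J. q \<le> k" for q
  proof (rule ccontr)
    let ?A = "f q (F q)"
    assume "\<not> ?thesis"
    then have "\<forall>k\<in>?A. k \<notin> J"
      using f[OF large[of q], of q] by auto
    then have "\<forall>k\<in>?A. \<forall>\<^sub>F n in sequentially. k \<notin> s (r n)"
      using r(2) by (auto simp: J_def)
    then have "\<forall>\<^sub>F n in sequentially. \<forall>k\<in>?A. k \<notin> s (r n)"
      using f[OF large[of q], of q] by (intro eventually_ball_finite) auto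
    then have "\<forall>\<^sub>F n in sequentially. n \<ge> Suc q \<and> (\<forall>k\<in>?A. k \<notin> s (r n))"
      using eventually_ge_at_top by (rule eventually_conj[rotated])
    then obtain n where n: "n \<ge> Suc q" "\<forall>k\<in>?A. k \<notin> s (r n)"
      by (auto simp: eventually_sequentially)
    have "Suc q \<le> r n"
      using n(1) seq_suble[OF r(1), of n] by linarith
    then have "s (r n) \<in> F (Suc q)"
      using F_anti s by blast
    then show False using n(2) by (auto simp: FS)
  qed
  then have "infinite J"
    by (meson finite_nat_set_iff_bounded not_le)
  moreover have "s (r n) \<in> \<S>" for n
    using F_anti[of 0 "r n"] s by (auto simp: F0)
  ultimately show ?thesis
    by (intro exI[of _ J] exI[of _ "s \<circ> r"]) (auto simp: J_def)
qed

section \<open>Approximate minimax by approachability\<close>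

text \<open>Blackwell's approachability strategy: always answer the current vector of positive excesses,
  whose squared length then grows only linearly in time.\<close>

lemma approachability:
  fixes h :: "'v \<Rightarrow> 'e \<Rightarrow> real" and b b' :: real
  assumes "finite R" "X \<noteq> {}" "b < b'" and b: "0 \<le> b" "b \<le> 1"
    and h: "\<And>v e. 0 \<le> h v e \<and> h v e \<le> 1"
    and resp: "\<And>g. (\<And>v. v \<in> R \<Longrightarrow> 0 \<le> g v) \<Longrightarrow> sum g R = 1 \<Longrightarrow> \<exists>e\<in>X. (\<Sum>v\<in>R. g v * h v e) \<le> b"
  shows "\<exists>T>0. \<exists>e. (\<forall>t. e t \<in> X) \<and> (\<forall>v\<in>R. (\<Sum>t<T. h v (e t)) \<le> b' * real T)"
proof -
  \<comment> \<open>The response assumption is extended from probabilities to arbitrary nonnegative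
    weights by normalising; for zero weights any element of \<open>X\<close> will do.\<close>
  have resp': "\<exists>e\<in>X. (\<Sum>v\<in>R. g v * (h v e - b)) \<le> 0" if g: "\<And>v. v \<in> R \<Longrightarrow> 0 \<le> g v" for g
  proof (cases "sum g R = 0")
    case True
    then have "\<forall>v\<in>R. g v = 0" using g \<open>finite R\<close> by (simp add: sum_nonneg_eq_0_iff)
    then show ?thesis using \<open>X \<noteq> {}\<close> by auto
  next
    case False
    let ?s = "sum g R"
    have s: "?s > 0" using False sum_nonneg[of R g] g by (simp add: less_le)
    obtain e where e: "e \<in> X" "(\<Sum>v\<in>R. g v / ?s * h v e) \<le> b"
      using resp[of "\<lambda>v. g v / ?s"] g s by (auto simp: sum_divide_distrib[symmetric])
    have "(\<Sum>v\<in>R. g v / ?s * h v e) = (\<Sum>v\<in>R. g v * h v e) / ?s"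
      by (simp add: sum_divide_distrib)
    then have "(\<Sum>v\<in>R. g v * h v e) \<le> b * ?s" using e(2) s by (simp add: pos_divide_le_eq)
    then have "(\<Sum>v\<in>R. g v * (h v e - b)) \<le> 0"
      by (simp add: right_diff_distrib sum_subtractf sum_distrib_left mult.commute)
    then show ?thesis using e(1) by blast
  qed
  define pick where "pick D = (SOME e. e \<in> X \<and> (\<Sum>v\<in>R. max 0 (D v) * (h v e - b)) \<le> 0)" for D
  have pick: "pick D \<in> X \<and> (\<Sum>v\<in>R. max 0 (D v) * (h v (pick D) - b)) \<le> 0" for D
    unfolding pick_def by (rule someI_ex) (use resp'[of "\<lambda>v. max 0 (D v)"] in auto)
  define D where "D = rec_nat (\<lambda>_. 0) (\<lambda>_ d v. d v + (h v (pick d) - b))"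
  have D0: "D 0 v = 0" and DS: "D (Suc n) v = D n v + (h v (pick (D n)) - b)" for n v
    by (simp_all add: D_def)
  define e where "e t = pick (D t)" for t
  have D: "D n v = (\<Sum>t<n. h v (e t)) - b * n" for n v
    by (induction n) (auto simp: D0 DS e_def algebra_simps)
  have sq: "(max 0 (x + y))\<^sup>2 \<le> (max 0 x)\<^sup>2 + 2 * (max 0 x * y) + y\<^sup>2" for x y :: real
  proof -
    have "(max 0 (x + y))\<^sup>2 \<le> (max 0 x + y)\<^sup>2"
    proof (cases "x + y \<le> 0")
      case False
      then show ?thesis by (intro power_mono) auto
    qed simp
    then show ?thesis by (simp add: power2_sum algebra_simps)
  qed
  \<comment> \<open>In each round the cross term is at most 0 by the choice of \<open>pick\<close>,
    and each of the \<open>card R\<close> squared increments is at most 1.\<close>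
  have pot: "(\<Sum>v\<in>R. (max 0 (D n v))\<^sup>2) \<le> real (card R) * real n" for n
  proof (induction n)
    case (Suc n)
    have "(\<Sum>v\<in>R. (max 0 (D (Suc n) v))\<^sup>2) \<le>
      (\<Sum>v\<in>R. (max 0 (D n v))\<^sup>2 + 2 * (max 0 (D n v) * (h v (e n) - b)) + 1)"
    proof (rule sum_mono)
      fix v
      have "\<bar>h v (e n) - b\<bar> \<le> 1" using h[of v "e n"] b by (auto simp: abs_le_iff)
      then have "(h v (e n) - b)\<^sup>2 \<le> 1" by (simp add: abs_square_le_1)
      then show "(max 0 (D (Suc n) v))\<^sup>2 \<le>
          (max 0 (D n v))\<^sup>2 + 2 * (max 0 (D n v) * (h v (e n) - b)) + 1"
        using sq[of "D n v" "h v (e n) - b"] by (simp add: DS e_def)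
    qed
    also have "\<dots> = (\<Sum>v\<in>R. (max 0 (D n v))\<^sup>2) + 2 * (\<Sum>v\<in>R. max 0 (D n v) * (h v (e n) - b)) + card R"
      by (simp add: sum.distrib sum_distrib_left)
    also have "\<dots> \<le> real (card R) * real n + 0 + card R"
      using Suc pick[of "D n"] by (simp add: e_def)
    finally show ?case by (simp add: algebra_simps)
  qed (simp add: D0)
  \<comment> \<open>This makes \<open>card R * T\<close> at most the square of
    \<open>(b' - b) * T\<close>, so that no excess over \<open>b * T\<close> is larger than
    \<open>(b' - b) * T\<close>.\<close>
  obtain T :: nat where T: "card R / (b' - b)\<^sup>2 < T" using reals_Archimedean2 by blast
  have "T > 0"
    using T by (smt (verit) divide_nonneg_nonneg of_nat_0_le_iff of_nat_0_less_iff zero_le_power2)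
  moreover have "(\<Sum>t<T. h v (e t)) \<le> b' * T" if "v \<in> R" for v
  proof -
    have "(max 0 (D T v))\<^sup>2 \<le> (\<Sum>v\<in>R. (max 0 (D T v))\<^sup>2)"
      using \<open>finite R\<close> that by (intro member_le_sum) auto
    also have "\<dots> \<le> real (card R) * real T" by (rule pot)
    also have "\<dots> \<le> ((b' - b)\<^sup>2 * T) * T"
      using T \<open>b < b'\<close> by (intro mult_right_mono) (auto simp: field_simps)
    also have "\<dots> = ((b' - b) * T)\<^sup>2" by (simp add: power_mult_distrib power2_eq_square[of "real T"])
    finally have "max 0 (D T v) \<le> (b' - b) * T"
      by (rule power2_le_imp_le) (use \<open>b < b'\<close> in simp)
    then show ?thesis by (simp add: D algebra_simps)
  qed
  moreover have "e t \<in> X" for t using pick by (simp add: e_def)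
  ultimately show ?thesis by blast
qed

lemma ex_ge_avg:
  fixes x :: "'i \<Rightarrow> real" and c :: real
  assumes "finite I" "I \<noteq> {}" "c * card I \<le> sum x I"
  shows "\<exists>i\<in>I. c \<le> x i"
proof (rule ccontr)
  assume "\<not> ?thesis"
  then have "sum x I < (\<Sum>i\<in>I. c)"
    using assms by (intro sum_strict_mono) auto
  then show False using assms(3) by (simp add: mult.commute)
qed

section \<open>Types of vertices over finitely many edges\<close>

lemma finite_type_representatives:
  fixes V :: "'a set"
  shows "\<exists>rep :: 'a set set \<Rightarrow> 'a set. mono rep \<and>
    (\<forall>F. finite F \<longrightarrow> finite (rep F) \<and> rep F \<subseteq> V \<and>
      (\<forall>v\<in>V. \<exists>v'\<in>rep F. \<forall>E\<in>F. v' \<in> E \<longleftrightarrow> v \<in> E))"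
proof -
  define good where "good P v \<longleftrightarrow> v \<in> V \<and> (\<forall>E\<in>fst P. v \<in> E) \<and> (\<forall>E\<in>snd P. v \<notin> E)"
    for P :: "'a set set \<times> 'a set set" and v
  \<comment> \<open>The chosen vertex depends on the pair of prescribed and forbidden edges alone,
    not on \<open>F\<close>, and the pairs need not exhaust \<open>F\<close>. Hence enlarging
    \<open>F\<close> only adds representatives, which gives monotonicity.\<close>
  define rep where "rep F = (\<lambda>P. SOME v. good P v) ` {P. fst P \<subseteq> F \<and> snd P \<subseteq> F \<and> (\<exists>v. good P v)}" for F
  have good: "good P (SOME v. good P v)" if "\<exists>v. good P v" for P
    using that by (rule someI_ex)
  show ?thesis
  proof (intro exI[of _ rep] conjI allI impI ballI)
    show "mono rep"
      unfolding rep_def by (rule monoI) auto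
    fix F :: "'a set set"
    assume "finite F"
    then have "finite (Pow F \<times> Pow F)" by simp
    then have "finite {P. fst P \<subseteq> F \<and> snd P \<subseteq> F \<and> (\<exists>v. good P v)}"
      by (rule rev_finite_subset) auto
    then show "finite (rep F)"
      unfolding rep_def by (rule finite_imageI)
    show "rep F \<subseteq> V"
    proof
      fix y assume "y \<in> rep F"
      then obtain P where "y = (SOME v. good P v)" "\<exists>v. good P v" by (auto simp: rep_def)
      then have "good P y" using good by simp
      then show "y \<in> V" by (simp add: good_def)
    qed
    fix v assume "v \<in> V"
    define P where "P = ({E \<in> F. v \<in> E}, {E \<in> F. v \<notin> E})"
    have "good P v" using \<open>v \<in> V\<close> by (auto simp: good_def P_def)
    then have "\<exists>v. good P v" by blast
    then have "(SOME v. good P v) \<in> rep F"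
      unfolding rep_def by (intro imageI) (auto simp: P_def)
    with good[OF \<open>\<exists>v. good P v\<close>] show "\<exists>v'\<in>rep F. \<forall>E\<in>F. v' \<in> E \<longleftrightarrow> v \<in> E"
      by (intro bexI[of _ "SOME v. good P v"]) (auto simp: good_def P_def)
  qed
qed

section \<open>Finding a tail in a duality gap\<close>

text \<open>The edges are taken from \<open>Es\<close> itself rather than as traces on the vertices
  \<open>a l\<close>. The equivalence alone forces the \<open>a l\<close> to be distinct, and
  likewise the traces of the \<open>C j\<close>.\<close>

definition has_tail :: "'a set \<Rightarrow> 'a set set \<Rightarrow> bool" where
  "has_tail V Es \<longleftrightarrow> (\<exists>a C. (\<forall>l. a l \<in> V) \<and> (\<forall>j. C j \<in> Es) \<and> (\<forall>l j :: nat. a l \<in> C j \<longleftrightarrow> j \<le> l))"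

text \<open>The two iterated limits of membership disagree. Choosing indices that grow fast enough
  turns both limits into exact statements: the selected edge for \<open>i j\<close> misses all
  selected vertices up to \<open>i j\<close> and contains all later ones.\<close>

lemma has_tail_of_double_limit:
  fixes v :: "nat \<Rightarrow> 'a" and C :: "nat \<Rightarrow> 'a set"
  assumes "infinite I" "\<And>i. v i \<in> V" "\<And>n. C n \<in> Es"
    and avoid: "\<And>i. i \<in> I \<Longrightarrow> \<forall>\<^sub>F n in sequentially. v i \<notin> C n"
    and hit: "\<And>n. \<forall>\<^sub>F i in sequentially. v i \<in> C n"
  shows "has_tail V Es"
proof -
  have "\<exists>p. \<forall>i\<in>I. i \<le> k \<longrightarrow> v i \<notin> C p" for k
  proof -
    have "\<forall>\<^sub>F n in sequentially. \<forall>i\<in>I \<inter> {..k}. v i \<notin> C n"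
      by (rule eventually_ball_finite) (use avoid in auto)
    then show ?thesis by (auto simp: eventually_sequentially)
  qed
  then obtain p where p: "\<And>k i. i \<in> I \<Longrightarrow> i \<le> k \<Longrightarrow> v i \<notin> C (p k)" by metis
  have "\<exists>q. \<forall>i\<ge>q. v i \<in> C n" for n
    using hit[of n] by (simp add: eventually_sequentially)
  then obtain q where q: "\<And>n i. q n \<le> i \<Longrightarrow> v i \<in> C n" by metis
  have step: "\<exists>y. y \<in> I \<and> x < y \<and> q (p x) \<le> y" for x
    using \<open>infinite I\<close> unfolding infinite_nat_iff_unbounded
    by (meson le_less_trans less_imp_le_nat max.cobounded1 max.cobounded2)
  have "\<exists>i. \<forall>n. i n \<in> I \<and> (i n < i (Suc n) \<and> q (p (i n)) \<le> i (Suc n))"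
  proof (rule dependent_nat_choice)
    show "\<exists>x. x \<in> I" using step by blast
  qed (use step in blast)
  then obtain i where i: "\<And>n. i n \<in> I" "\<And>n. i n < i (Suc n)" "\<And>n. q (p (i n)) \<le> i (Suc n)"
    by blast
  have "strict_mono i" using i(2) by (simp add: strict_mono_Suc_iff)
  then have mono: "i m \<le> i n" if "m \<le> n" for m n
    using that by (simp add: strict_mono_less_eq)
  \<comment> \<open>The vertices are shifted by one, since the edge chosen for \<open>i j\<close>
    misses \<open>v (i j)\<close> and first contains \<open>v (i (Suc j))\<close>.\<close>
  have "v (i (Suc l)) \<in> C (p (i j)) \<longleftrightarrow> j \<le> l" for l j
  proof
    assume "j \<le> l"
    then have "q (p (i j)) \<le> i (Suc l)"
      using i(3)[of j] mono[of "Suc j" "Suc l"] by simp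
    then show "v (i (Suc l)) \<in> C (p (i j))" by (rule q)
  next
    assume "v (i (Suc l)) \<in> C (p (i j))"
    then have "\<not> i (Suc l) \<le> i j" using p i(1) by blast
    then show "j \<le> l" using mono[of "Suc l" j] by (metis not_less_eq_eq)
  qed
  then show ?thesis
    unfolding has_tail_def using assms(2,3)
    by (intro exI[of _ "\<lambda>l. v (i (Suc l))"] exI[of _ "\<lambda>j. C (p (i j))"]) simp
qed

text \<open>In \<open>edges\<close> the weights sit on an indexed family, because the averages built
  below may repeat an edge; the index pairs are a block number and a position in the block.\<close>

lemma has_tail_of_duality_gap:
  fixes V :: "'a set" and Es :: "'a set set" and a b :: real
  assumes ab: "0 \<le> b" "b < a" and "Es \<noteq> {}"
    and edges: "\<And>(I :: (nat \<times> nat) set) c C. finite I \<Longrightarrow> (\<And>i. i \<in> I \<Longrightarrow> 0 \<le> c i) \<Longrightarrow> sum c I = 1 \<Longrightarrow>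
      (\<And>i. i \<in> I \<Longrightarrow> C i \<in> Es) \<Longrightarrow> \<exists>v\<in>V. a \<le> (\<Sum>i\<in>I. c i * of_bool (v \<in> C i))"
    and vertices: "\<And>W g. finite W \<Longrightarrow> W \<subseteq> V \<Longrightarrow> (\<And>v. v \<in> W \<Longrightarrow> 0 \<le> g v) \<Longrightarrow> sum g W = 1 \<Longrightarrow>
      \<exists>E\<in>Es. (\<Sum>v\<in>W. g v * of_bool (v \<in> E)) \<le> b"
  shows "has_tail V Es"
proof -
  obtain E0 where "E0 \<in> Es" using \<open>Es \<noteq> {}\<close> by blast
  then obtain v0 where "a \<le> of_bool (v0 \<in> E0)"
    using edges[of "{(0, 0)}" "\<lambda>_. 1" "\<lambda>_. E0"] by auto
  then have "b \<le> 1" using ab(2) by (auto split: if_splits simp: of_bool_def)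
  \<comment> \<open>Vertices seen early get average at most \<open>b'\<close> in later blocks, and
    \<open>a'\<close> is the threshold for a large average. The gaps \<open>a - a'\<close> and
    \<open>a' - b'\<close> are the constants for the two uses of \<open>ptak\<close>.\<close>
  obtain b' where b': "b < b'" "b' < a" using dense[OF ab(2)] by blast
  obtain a' where a': "b' < a'" "a' < a" using dense[OF b'(2)] by blast
  have "a' > 0" using ab a' b' by linarith
  obtain rep :: "'a set set \<Rightarrow> 'a set" where "mono rep"
    and rep: "\<And>F. finite F \<Longrightarrow> finite (rep F)" "\<And>F. finite F \<Longrightarrow> rep F \<subseteq> V"
      "\<And>F v. finite F \<Longrightarrow> v \<in> V \<Longrightarrow> \<exists>v'\<in>rep F. \<forall>E\<in>F. v' \<in> E \<longleftrightarrow> v \<in> E"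
    using finite_type_representatives[of V] by metis
  have "\<exists>T>0. \<exists>e. (\<forall>t. e t \<in> Es) \<and> (\<forall>v\<in>R. (\<Sum>t<T. of_bool (v \<in> e t)) \<le> b' * real T)"
    if R: "finite R" "R \<subseteq> V" for R
    using vertices[OF R]
    by (intro approachability[OF R(1) \<open>Es \<noteq> {}\<close> b'(1) ab(1) \<open>b \<le> 1\<close>,
        where h = "\<lambda>v E. of_bool (v \<in> E)"]) auto
  then obtain Tf ef where Tf: "\<And>R. finite R \<Longrightarrow> R \<subseteq> V \<Longrightarrow> (0::nat) < Tf R \<and> (\<forall>t. ef R t \<in> Es) \<and>
      (\<forall>v\<in>R. (\<Sum>t<Tf R. of_bool (v \<in> ef R t)) \<le> b' * real (Tf R))"
    by metis
  \<comment> \<open>\<open>F n\<close> collects the edges of the first \<open>n\<close> blocks;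
    block \<open>n\<close> is the answer to the representatives of all types over
    \<open>F n\<close>.\<close>
  define F where "F = rec_nat {} (\<lambda>_ X. X \<union> ef (rep X) ` {..<Tf (rep X)})"
  have F0: "F 0 = {}" and FS: "F (Suc n) = F n \<union> ef (rep (F n)) ` {..<Tf (rep (F n))}" for n
    by (simp_all add: F_def)
  have fin: "finite (F n)" for n
    by (induction n) (auto simp: F0 FS)
  have "mono F"
    by (rule incseq_SucI) (auto simp: FS)
  define T where "T n = Tf (rep (F n))" for n
  define e where "e n = ef (rep (F n))" for n
  have Te: "0 < T n" "e n t \<in> Es" "v \<in> rep (F n) \<Longrightarrow> (\<Sum>t<T n. of_bool (v \<in> e n t)) \<le> b' * real (T n)"
    for n t v
    using Tf[OF rep(1)[OF fin] rep(2)[OF fin], of n] by (auto simp: T_def e_def)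
  have eF: "e j t \<in> F n" if "j < n" "t < T j" for j n t
    using monoD[OF \<open>mono F\<close>, of "Suc j" n] that by (auto simp: FS T_def e_def)
  define avg where "avg n v = (\<Sum>t<T n. of_bool (v \<in> e n t)) / real (T n)" for n v
  define V0 where "V0 = (\<Union>n. rep (F n))"
  have V0: "V0 \<subseteq> V" using rep(2)[OF fin] by (auto simp: V0_def)
  have avg_small: "\<exists>m. \<forall>n\<ge>m. avg n v \<le> b'" if v: "v \<in> V0" for v
  proof -
    obtain m where "v \<in> rep (F m)" using v by (auto simp: V0_def)
    then have "v \<in> rep (F n)" if "n \<ge> m" for n
      using monoD[OF \<open>mono rep\<close> monoD[OF \<open>mono F\<close> that]] by blast
    then show ?thesis
      using Te(1,3) by (intro exI[of _ m]) (auto simp: avg_def pos_divide_le_eq)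
  qed
  have avg_le1: "avg n v \<le> 1" for n v
  proof -
    have "(\<Sum>t<T n. of_bool (v \<in> e n t)) \<le> (\<Sum>t<T n. 1::real)"
      by (rule sum_mono) simp
    then show ?thesis using Te(1)[of n] by (simp add: avg_def)
  qed

  let ?S = "\<lambda>v. {j. a' \<le> avg j v}"
  \<comment> \<open>A probability on blocks is spread evenly over their edges. The vertex given by
    \<open>edges\<close> is replaced by one in \<open>V0\<close> of the same type over the blocks
    involved, and Markov's inequality bounds the mass of the blocks with average at least
    \<open>a'\<close>.\<close>
  have "\<exists>J s. infinite J \<and> (\<forall>n. s n \<in> ?S ` V0) \<and> (\<forall>j\<in>J. \<forall>\<^sub>F n in sequentially. j \<in> s n)"
  proof (rule ptak[of "a - a'"])
    show "0 < a - a'" using a' by simp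
    fix B :: "nat set" and w :: "nat \<Rightarrow> real"
    assume B: "finite B" "\<And>j. j \<in> B \<Longrightarrow> 0 \<le> w j" "sum w B = 1"
    let ?I = "SIGMA j:B. {..<T j}"
    have sums: "(\<Sum>(j,t)\<in>?I. w j / real (T j) * x j t) = (\<Sum>j\<in>B. w j * ((\<Sum>t<T j. x j t) / T j))" for x
    proof -
      have "(\<Sum>(j,t)\<in>?I. w j / real (T j) * x j t) = (\<Sum>j\<in>B. \<Sum>t<T j. w j / real (T j) * x j t)"
        using B(1) by (subst sum.Sigma[symmetric]) auto
      then show ?thesis by (simp add: sum_distrib_left sum_divide_distrib)
    qed
    have "\<exists>v\<in>V. a \<le> (\<Sum>i\<in>?I. (case i of (j,t) \<Rightarrow> w j / T j) * of_bool (v \<in> (case i of (j,t) \<Rightarrow> e j t)))"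
    proof (rule edges)
      show "finite ?I" using B(1) by simp
      show "(\<Sum>i\<in>?I. case i of (j,t) \<Rightarrow> w j / T j) = 1"
        using sums[of "\<lambda>_ _. 1"] less_imp_neq[OF Te(1), symmetric] B(3) by simp
    qed (use B(2) Te(2) in auto)
    then obtain v where v: "v \<in> V" "a \<le> (\<Sum>j\<in>B. w j * avg j v)"
      using sums[of "\<lambda>j t. of_bool (_ \<in> e j t)"] by (auto simp: avg_def case_prod_unfold)
    obtain n where n: "\<And>j. j \<in> B \<Longrightarrow> j < n"
      using B(1) finite_nat_set_iff_bounded by auto
    obtain v' where v': "v' \<in> rep (F n)" "\<And>E. E \<in> F n \<Longrightarrow> v' \<in> E \<longleftrightarrow> v \<in> E"
      using rep(3)[OF fin[of n] v(1)] by auto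
    have avg_eq: "avg j v' = avg j v" if "j \<in> B" for j
      unfolding avg_def using v'(2)[OF eF[OF n[OF that]]] by simp
    have "(\<Sum>j\<in>B. w j * avg j v') \<le> (\<Sum>j\<in>B. w j * a' + (if j \<in> ?S v' then w j else 0))"
    proof (rule sum_mono)
      fix j assume j: "j \<in> B"
      show "w j * avg j v' \<le> w j * a' + (if j \<in> ?S v' then w j else 0)"
      proof (cases "a' \<le> avg j v'")
        case True
        have "w j * avg j v' \<le> w j * 1" using avg_le1 B(2)[OF j] by (rule mult_left_mono)
        moreover have "0 \<le> w j * a'" using B(2)[OF j] \<open>a' > 0\<close> by simp
        ultimately show ?thesis using True by simp
      next
        case False
        then show ?thesis using B(2)[OF j] by (simp add: mult_left_mono)
      qed
    qed
    also have "\<dots> = a' + sum w (B \<inter> ?S v')"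
      using B(1,3) by (simp add: sum.distrib sum_distrib_right[symmetric] sum.inter_restrict)
    finally have "a - a' \<le> sum w (B \<inter> ?S v')"
      using v(2) avg_eq by simp
    moreover have "v' \<in> V0" using v'(1) by (auto simp: V0_def)
    ultimately show "\<exists>S\<in>?S ` V0. a - a' \<le> sum w (B \<inter> S)" by blast
  qed
  then obtain J s where J: "infinite J" "\<And>n. s n \<in> ?S ` V0"
    "\<And>j. j \<in> J \<Longrightarrow> \<forall>\<^sub>F n in sequentially. j \<in> s n"
    by blast
  have "\<exists>v. v \<in> V0 \<and> s n = ?S v" for n using J(2)[of n] by blast
  then obtain u where u: "\<And>n. u n \<in> V0" "\<And>n. s n = ?S (u n)" by metis

  \<comment> \<open>After thinning, membership in each of the countably many edges
    \<open>e j t\<close> is eventually constant along the sequence.\<close>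
  obtain r where r: "strict_mono r"
    "\<And>k. (\<forall>\<^sub>F n in sequentially. u (r n) \<in> case_prod e (prod_decode k)) \<or>
         (\<forall>\<^sub>F n in sequentially. u (r n) \<notin> case_prod e (prod_decode k))"
    using subseq_eventually_decides[of "\<lambda>k n. u n \<in> case_prod e (prod_decode k)"] by blast
  define v where "v n = u (r n)" for n
  have v: "v n \<in> V0" for n using u by (simp add: v_def)
  have dec: "(\<forall>\<^sub>F n in sequentially. v n \<in> e j t) \<or> (\<forall>\<^sub>F n in sequentially. v n \<notin> e j t)" for j t
    using r(2)[of "prod_encode (j, t)"] by (simp add: v_def)
  have avg_v: "\<forall>\<^sub>F n in sequentially. a' \<le> avg j (v n)" if "j \<in> J" for j
    using eventually_subseq[OF r(1) J(3)[OF that]] by (simp add: u(2) v_def)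
  define Tx where "Tx = {E \<in> Es. \<forall>\<^sub>F n in sequentially. v n \<in> E}"
  \<comment> \<open>A block is finite, so for one late \<open>n\<close> the vertex
    \<open>v n\<close> lies in exactly those of its edges that belong to \<open>Tx\<close>.\<close>
  have Tx_avg: "a' * real (T j) \<le> (\<Sum>t<T j. of_bool (e j t \<in> Tx))" if "j \<in> J" for j
  proof -
    have "\<forall>\<^sub>F n in sequentially. v n \<in> e j t \<longleftrightarrow> e j t \<in> Tx" for t
    proof (cases "e j t \<in> Tx")
      case True
      then show ?thesis by (simp add: Tx_def)
    next
      case False
      then have "\<forall>\<^sub>F n in sequentially. v n \<notin> e j t"
        using dec Te(2) by (auto simp: Tx_def)
      with False show ?thesis by simp
    qed
    then have "\<forall>\<^sub>F n in sequentially. \<forall>t\<in>{..<T j}. v n \<in> e j t \<longleftrightarrow> e j t \<in> Tx"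
      by (intro eventually_ball_finite) auto
    with avg_v[OF that]
    have "\<forall>\<^sub>F n in sequentially. a' \<le> avg j (v n) \<and> (\<forall>t\<in>{..<T j}. v n \<in> e j t \<longleftrightarrow> e j t \<in> Tx)"
      by (rule eventually_conj)
    then obtain n where "a' \<le> avg j (v n)" "\<forall>t\<in>{..<T j}. v n \<in> e j t \<longleftrightarrow> e j t \<in> Tx"
      by (auto simp: eventually_sequentially)
    then show ?thesis
      using Te(1)[of j] by (simp add: avg_def pos_le_divide_eq)
  qed

  let ?A = "\<lambda>E. {i. v i \<notin> E}"
  \<comment> \<open>Given weights on finitely many \<open>v i\<close>, a late block \<open>j\<close>
    in \<open>J\<close> has a fraction at least \<open>a'\<close> of its edges in \<open>Tx\<close>,
    while its edges contain weight at most \<open>b'\<close> on average.\<close>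
  have "\<exists>I s. infinite I \<and> (\<forall>n. s n \<in> ?A ` Tx) \<and> (\<forall>i\<in>I. \<forall>\<^sub>F n in sequentially. i \<in> s n)"
  proof (rule ptak[of "a' - b'"])
    show "0 < a' - b'" using a' by simp
    fix B :: "nat set" and w :: "nat \<Rightarrow> real"
    assume B: "finite B" "\<And>j. j \<in> B \<Longrightarrow> 0 \<le> w j" "sum w B = 1"
    obtain m where m: "\<And>i n. m i \<le> n \<Longrightarrow> avg n (v i) \<le> b'"
      using avg_small[OF v] by metis
    obtain j where j: "j \<in> J" "\<And>i. i \<in> B \<Longrightarrow> m i \<le> j"
    proof -
      obtain k where "\<And>i. i \<in> B \<Longrightarrow> m i \<le> k"
        using B(1) finite_nat_set_iff_bounded_le[of "m ` B"] by auto
      moreover obtain j where "j \<in> J" "k < j"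
        using J(1) by (auto simp: infinite_nat_iff_unbounded)
      ultimately show thesis by (intro that[of j]) fastforce+
    qed
    \<comment> \<open>A positive \<open>x t\<close> forces \<open>e j t\<close> into
      \<open>Tx\<close>, as the subtracted sum is nonnegative; then \<open>x t\<close> is exactly
      the weight missed by that edge.\<close>
    define x where "x t = of_bool (e j t \<in> Tx) - (\<Sum>i\<in>B. w i * of_bool (v i \<in> e j t))" for t
    have "(\<Sum>t<T j. \<Sum>i\<in>B. w i * of_bool (v i \<in> e j t)) = (\<Sum>i\<in>B. w i * (\<Sum>t<T j. of_bool (v i \<in> e j t)))"
      unfolding sum_distrib_left by (rule sum.swap)
    also have "\<dots> \<le> (\<Sum>i\<in>B. w i * (b' * real (T j)))"
    proof (rule sum_mono)
      fix i assume i: "i \<in> B"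
      have "(\<Sum>t<T j. of_bool (v i \<in> e j t)) \<le> b' * real (T j)"
        using m[OF j(2)[OF i]] Te(1)[of j] by (simp add: avg_def pos_divide_le_eq)
      then show "w i * (\<Sum>t<T j. of_bool (v i \<in> e j t)) \<le> w i * (b' * real (T j))"
        using B(2)[OF i] by (rule mult_left_mono)
    qed
    also have "\<dots> = b' * real (T j)"
      using B(3) by (simp add: sum_distrib_right[symmetric])
    finally have "(a' - b') * card {..<T j} \<le> sum x {..<T j}"
      using Tx_avg[OF j(1)] by (simp add: x_def sum_subtractf left_diff_distrib)
    then obtain t where t: "t < T j" "a' - b' \<le> x t"
      using ex_ge_avg[of "{..<T j}" "a' - b'" x] Te(1)[of j] by auto
    have nonneg: "0 \<le> (\<Sum>i\<in>B. w i * of_bool (v i \<in> e j t))"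
      using B(2) by (intro sum_nonneg) auto
    then have "e j t \<in> Tx" using t(2) a' by (cases "e j t \<in> Tx") (auto simp: x_def)
    moreover have "x t \<le> sum w (B \<inter> ?A (e j t))"
    proof -
      have "1 - (\<Sum>i\<in>B. w i * of_bool (v i \<in> e j t)) = (\<Sum>i\<in>B. w i - w i * of_bool (v i \<in> e j t))"
        using B(3) by (simp add: sum_subtractf)
      also have "\<dots> = (\<Sum>i\<in>B. if i \<in> ?A (e j t) then w i else 0)"
        by (rule sum.cong) auto
      also have "\<dots> = sum w (B \<inter> ?A (e j t))"
        using B(1) by (simp add: sum.inter_restrict)
      finally show ?thesis using \<open>e j t \<in> Tx\<close> by (simp add: x_def)
    qed
    ultimately show "\<exists>S\<in>?A ` Tx. a' - b' \<le> sum w (B \<inter> S)"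
      using t(2) by (intro bexI[of _ "?A (e j t)"]) auto
  qed
  then obtain I s' where I: "infinite I" "\<And>n. s' n \<in> ?A ` Tx"
    "\<And>i. i \<in> I \<Longrightarrow> \<forall>\<^sub>F n in sequentially. i \<in> s' n"
    by blast
  have "\<exists>E. E \<in> Tx \<and> s' n = ?A E" for n using I(2)[of n] by blast
  then obtain C where C: "\<And>n. C n \<in> Tx" "\<And>n. s' n = ?A (C n)" by metis
  show ?thesis
  proof (rule has_tail_of_double_limit[of I v V C Es])
    show "\<forall>\<^sub>F n in sequentially. v i \<notin> C n" if "i \<in> I" for i
      using I(3)[OF that] by (simp add: C(2))
    show "v i \<in> V" for i using v V0 by blast
    show "C n \<in> Es" "\<forall>\<^sub>F i in sequentially. v i \<in> C n" for n
      using C(1)[of n] by (auto simp: Tx_def)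
  qed (rule I(1))
qed

section \<open>Duality for fractional matchings and covers\<close>

lemma nnsum_upper: "finite F \<Longrightarrow> F \<subseteq> A \<Longrightarrow> ennreal (sum f F) \<le> nnsum f A"
  unfolding nnsum_def by (rule SUP_upper) simp

lemma nnsum_least: "(\<And>F. finite F \<Longrightarrow> F \<subseteq> A \<Longrightarrow> ennreal (sum f F) \<le> c) \<Longrightarrow> nnsum f A \<le> c"
  unfolding nnsum_def by (rule SUP_least) simp

lemma less_nnsumD:
  assumes "ennreal z < nnsum f A" "0 \<le> z"
  shows "\<exists>F. finite F \<and> F \<subseteq> A \<and> z < sum f F"
proof -
  obtain F where "finite F" "F \<subseteq> A" "ennreal z < ennreal (sum f F)"
    using assms(1) unfolding nnsum_def less_SUP_iff by blast
  then show ?thesis using assms(2) by (auto simp: ennreal_less_iff)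
qed

text \<open>Double counting, carried out on finitely many edges and a finite set of vertices that
  carries almost all of the required cover mass of each of them.\<close>

lemma weak_duality:
  assumes "hypergraph V Es" and f: "frac_matching V Es f" and g: "frac_cover V Es g"
  shows "nnsum f Es \<le> nnsum g V"
proof (rule nnsum_least, rule ccontr)
  fix F assume F: "finite F" "F \<subseteq> Es" and "\<not> ennreal (sum f F) \<le> nnsum g V"
  define s where "s = sum f F"
  have less: "nnsum g V < ennreal s"
    using \<open>\<not> _\<close> by (simp add: s_def)
  then obtain G where G: "nnsum g V = ennreal G" "0 \<le> G"
    by (cases "nnsum g V") auto
  then have "G < s" using less by (simp add: ennreal_less_iff)
  then have "G / s < 1" using G(2) by simp
  \<comment> \<open>Finite parts of an edge are only sure to exceed masses below 1; any
    \<open>z\<close> above \<open>G / s\<close> still suffices, since double counting yields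
    \<open>s * z \<le> G\<close>.\<close>
  then obtain z where z: "G / s < z" "z < 1" using dense by blast
  have "0 < s" using \<open>G < s\<close> G(2) by linarith
  then have "0 \<le> z" using z(1) G(2) by (smt (verit) divide_nonneg_pos)
  have "\<exists>W. finite W \<and> W \<subseteq> E \<and> z < sum g W" if "E \<in> F" for E
  proof (rule less_nnsumD)
    have "ennreal z < 1" using z(2) \<open>0 \<le> z\<close> by (simp add: ennreal_less_one_iff)
    also have "1 \<le> nnsum g E" using g F(2) that by (auto simp: frac_cover_def)
    finally show "ennreal z < nnsum g E" .
  qed fact
  then obtain W where W: "\<And>E. E \<in> F \<Longrightarrow> finite (W E) \<and> W E \<subseteq> E \<and> z < sum g (W E)"
    by metis
  define U where "U = (\<Union>E\<in>F. W E)"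
  have U: "finite U" "U \<subseteq> V"
    using W F assms(1) by (auto simp: U_def hypergraph_def, blast)
  have g0: "0 \<le> g v" if "v \<in> U" for v using g U(2) that by (auto simp: frac_cover_def)
  have f0: "0 \<le> f E" if "E \<in> F" for E using f F(2) that by (auto simp: frac_matching_def)
  have "s * z = (\<Sum>E\<in>F. f E * z)" by (simp add: s_def sum_distrib_right)
  also have "\<dots> \<le> (\<Sum>E\<in>F. f E * (\<Sum>v\<in>U. g v * of_bool (v \<in> E)))"
  proof (intro sum_mono mult_left_mono f0)
    fix E assume E: "E \<in> F"
    have "z \<le> sum g (W E)" using W[OF E] by simp
    also have "\<dots> \<le> sum g (U \<inter> E)"
      using W[OF E] U(1) g0 E by (intro sum_mono2) (auto simp: U_def)
    also have "\<dots> = (\<Sum>v\<in>U. g v * of_bool (v \<in> E))"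
      using U(1) by (simp add: sum.inter_restrict of_bool_def if_distrib cong: if_cong)
    finally show "z \<le> (\<Sum>v\<in>U. g v * of_bool (v \<in> E))" .
  qed
  also have "\<dots> = (\<Sum>v\<in>U. g v * (\<Sum>E\<in>F. f E * of_bool (v \<in> E)))"
    unfolding sum_distrib_left by (subst sum.swap) (simp add: mult_ac)
  also have "\<dots> \<le> (\<Sum>v\<in>U. g v * 1)"
  proof (intro sum_mono mult_left_mono g0)
    fix v assume v: "v \<in> U"
    have "ennreal (sum f {E \<in> F. v \<in> E}) \<le> nnsum f {E \<in> Es. v \<in> E}"
      using F by (intro nnsum_upper) auto
    also have "\<dots> \<le> 1" using f v U(2) by (auto simp: frac_matching_def)
    finally have "sum f {E \<in> F. v \<in> E} \<le> 1" by simp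
    moreover have "(\<Sum>E\<in>F. f E * of_bool (v \<in> E)) = sum f {E \<in> F. v \<in> E}"
      using F(1) by (simp add: sum.inter_filter of_bool_def if_distrib cong: if_cong)
    ultimately show "(\<Sum>E\<in>F. f E * of_bool (v \<in> E)) \<le> 1" by simp
  qed
  also have "\<dots> \<le> G"
    using nnsum_upper[OF U, of g] G by (simp add: ennreal_le_iff)
  finally show False
    using z(1) \<open>0 < s\<close> by (simp add: pos_divide_less_eq mult.commute)
qed

lemma nu_star_le_tau_star: "hypergraph V Es \<Longrightarrow> nu_star V Es \<le> tau_star V Es"
  unfolding nu_star_def tau_star_def by (auto intro!: SUP_least INF_greatest weak_duality)

text \<open>With \<open>N\<close> and \<open>M\<close> strictly inside the gap, a probability on
  edges violating the first condition would become, after scaling by \<open>N\<close>, a matching of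
  size \<open>N\<close>. One on vertices violating the second would become, after scaling by
  \<open>M\<close>, a cover of size at most \<open>M\<close>.\<close>

lemma nu_star_less_tau_star_imp_has_tail:
  assumes "nu_star V Es < tau_star V Es"
  shows "has_tail V Es"
proof -
  obtain x y where xy: "nu_star V Es < x" "x < y" "y < tau_star V Es"
    using assms by (meson dense)
  then obtain N M where NM: "x = ennreal N" "y = ennreal M" "0 \<le> N" "0 \<le> M"
    by (metis ennreal_cases infinity_ennreal_def not_top_less order_less_trans top_greatest less_top)
  have nu: "nu_star V Es < ennreal N" and tau: "ennreal M < tau_star V Es"
    using xy NM by auto
  have "N < M" using xy(2) NM by (simp add: ennreal_less_iff)
  have "0 < N" using nu NM by (metis ennreal_0 less_le not_less_zero)
  show ?thesis
  proof (rule has_tail_of_duality_gap[of "1 / M" "1 / N"])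
    show "0 \<le> 1 / M" "1 / M < 1 / N"
      using \<open>N < M\<close> \<open>0 < N\<close> by (auto intro: divide_strict_left_mono)
    show "Es \<noteq> {}"
    proof
      assume "Es = {}"
      then have "tau_star V Es \<le> nnsum (\<lambda>_. 0) V"
        unfolding tau_star_def by (intro INF_lower) (simp add: frac_cover_def)
      also have "\<dots> \<le> 0" by (rule nnsum_least) simp
      finally show False using assms by simp
    qed
  next
    fix I :: "(nat \<times> nat) set" and c :: "nat \<times> nat \<Rightarrow> real" and C
    assume I: "finite I" "\<And>i. i \<in> I \<Longrightarrow> 0 \<le> c i" "sum c I = 1" "\<And>i. i \<in> I \<Longrightarrow> C i \<in> Es"
    show "\<exists>v\<in>V. 1 / N \<le> (\<Sum>i\<in>I. c i * of_bool (v \<in> C i))"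
    proof (rule ccontr)
      assume small: "\<not> ?thesis"
      \<comment> \<open>\<open>C\<close> need not be injective, so the weights of all indices of the
        same edge are added.\<close>
      define f where "f E = N * (\<Sum>i\<in>I. c i * of_bool (C i = E))" for E
      have sum_f: "sum f F = N * (\<Sum>i\<in>I. c i * of_bool (C i \<in> F))" if "finite F" for F
      proof -
        have inner: "(\<Sum>E\<in>F. c i * of_bool (C i = E)) = c i * of_bool (C i \<in> F)" for i
          using that by (simp add: of_bool_def if_distrib sum.delta cong: if_cong)
        have "sum f F = N * (\<Sum>E\<in>F. \<Sum>i\<in>I. c i * of_bool (C i = E))"
          unfolding f_def sum_distrib_left ..
        also have "\<dots> = N * (\<Sum>i\<in>I. \<Sum>E\<in>F. c i * of_bool (C i = E))"
          by (subst sum.swap) (rule refl)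
        also have "\<dots> = N * (\<Sum>i\<in>I. c i * of_bool (C i \<in> F))"
          by (simp only: inner)
        finally show ?thesis .
      qed
      have "frac_matching V Es f"
        unfolding frac_matching_def
      proof (intro conjI ballI)
        show "0 \<le> f E" for E
          using I(2) \<open>0 < N\<close> by (auto simp: f_def intro!: mult_nonneg_nonneg sum_nonneg)
        fix v assume "v \<in> V"
        show "nnsum f {E \<in> Es. v \<in> E} \<le> 1"
        proof (rule nnsum_least)
          fix F assume F: "finite F" "F \<subseteq> {E \<in> Es. v \<in> E}"
          have "sum f F \<le> N * (\<Sum>i\<in>I. c i * of_bool (v \<in> C i))"
            unfolding sum_f[OF F(1)] using I(2) \<open>0 < N\<close> F(2)
            by (intro mult_left_mono sum_mono) auto
          also have "\<dots> \<le> N * (1 / N)"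
            using small \<open>v \<in> V\<close> \<open>0 < N\<close> by (intro mult_left_mono) auto
          finally show "ennreal (sum f F) \<le> 1" using \<open>0 < N\<close> by simp
        qed
      qed
      then have "nnsum f Es \<le> nu_star V Es"
        unfolding nu_star_def by (intro SUP_upper) simp
      moreover have "ennreal (sum f (C ` I)) \<le> nnsum f Es"
        using I by (intro nnsum_upper) auto
      moreover have "sum f (C ` I) = N"
        using I(1,3) by (simp add: sum_f)
      ultimately show False using nu by simp
    qed
  next
    fix W and g :: "'a \<Rightarrow> real"
    assume W: "finite W" "W \<subseteq> V" "\<And>v. v \<in> W \<Longrightarrow> 0 \<le> g v" "sum g W = 1"
    show "\<exists>E\<in>Es. (\<Sum>v\<in>W. g v * of_bool (v \<in> E)) \<le> 1 / M"
    proof (rule ccontr)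
      assume large: "\<not> ?thesis"
      have "0 < M" using \<open>N < M\<close> \<open>0 < N\<close> by simp
      define g' where "g' v = (if v \<in> W then M * g v else 0)" for v
      have g'0: "0 \<le> g' v" for v using W(3) \<open>0 < M\<close> by (simp add: g'_def)
      have "frac_cover V Es g'"
        unfolding frac_cover_def
      proof (intro conjI ballI g'0)
        fix E assume E: "E \<in> Es"
        have "1 \<le> M * (\<Sum>v\<in>W. g v * of_bool (v \<in> E))"
          using large E \<open>0 < M\<close> by (auto simp: not_le pos_divide_less_eq mult.commute less_imp_le)
        also have "\<dots> = sum g' (W \<inter> E)"
          using W(1) by (simp add: g'_def sum_distrib_left sum.inter_restrict of_bool_def if_distrib cong: if_cong)
        finally have "1 \<le> ennreal (sum g' (W \<inter> E))" by simp
        also have "\<dots> \<le> nnsum g' E" using W(1) by (intro nnsum_upper) auto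
        finally show "1 \<le> nnsum g' E" .
      qed
      then have "tau_star V Es \<le> nnsum g' V"
        unfolding tau_star_def by (intro INF_lower) simp
      also have "\<dots> \<le> ennreal M"
      proof (rule nnsum_least)
        fix F assume F: "finite F" "F \<subseteq> V"
        have "sum g' F \<le> sum g' (F \<union> W)" using F W g'0 by (intro sum_mono2) auto
        also have "\<dots> = sum g' W"
          using F W by (intro sum.mono_neutral_right) (auto simp: g'_def)
        also have "\<dots> = M" using W(4) by (simp add: g'_def sum_distrib_left[symmetric])
        finally show "ennreal (sum g' F) \<le> ennreal M" by (rule ennreal_leI)
      qed
      finally show False using tau by simp
    qed
  qed
qed

section \<open>Tails as partial sub-hypergraphs, and the equivalence\<close>

lemma has_tail_partial_sub_hypergraph:
  assumes "partial_sub_hypergraph V' Es' V Es" "has_tail V' Es'"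
  shows "has_tail V Es"
proof -
  obtain a C where aC: "\<And>l. a l \<in> V'" "\<And>j. C j \<in> Es'" "\<And>l j :: nat. a l \<in> C j \<longleftrightarrow> j \<le> l"
    using assms(2) unfolding has_tail_def by blast
  have "\<exists>D. D \<in> Es \<and> C j = D \<inter> V'" for j
    using assms(1) aC(2)[of j] by (auto simp: partial_sub_hypergraph_def)
  then obtain D where D: "\<And>j. D j \<in> Es" "\<And>j. C j = D j \<inter> V'" by metis
  have "a l \<in> V" for l using assms(1) aC(1) by (auto simp: partial_sub_hypergraph_def)
  moreover have "a l \<in> D j \<longleftrightarrow> j \<le> l" for l j using aC(1,3) D(2) by blast
  ultimately show ?thesis unfolding has_tail_def using D(1) by blast
qed

text \<open>Restricted to the vertices \<open>a l\<close>, the edge \<open>C j\<close> becomes the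
  image of \<open>{j..}\<close> under \<open>a\<close>, so the inverse of \<open>a\<close> is an
  isomorphism.\<close>

lemma has_tail_imp_tail_hypergraph:
  assumes "has_tail V Es"
  shows "\<exists>V' Es'. partial_sub_hypergraph V' Es' V Es \<and>
    hg_isomorphic V' Es' (UNIV :: nat set) tail_hypergraph_edges"
proof -
  obtain a C where aC: "\<And>l. a l \<in> V" "\<And>j. C j \<in> Es" "\<And>l j :: nat. a l \<in> C j \<longleftrightarrow> j \<le> l"
    using assms unfolding has_tail_def by blast
  have "inj a"
    by (rule injI) (metis aC(3) le_antisym order_refl)
  define Es' where "Es' = (\<lambda>E. E \<inter> range a) ` range C"
  have img: "inv a ` (C j \<inter> range a) = tail_edge j" for j
  proof -
    have "C j \<inter> range a = a ` {j..}" using aC(3) by auto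
    then show ?thesis
      using \<open>inj a\<close> by (simp add: image_image tail_edge_def atLeast_def)
  qed
  have "partial_sub_hypergraph (range a) Es' V Es"
    unfolding partial_sub_hypergraph_def Es'_def using aC(1,2) by blast
  moreover have "hg_isomorphic (range a) Es' (UNIV :: nat set) tail_hypergraph_edges"
    unfolding hg_isomorphic_def
  proof (intro exI[of _ "inv a"] conjI)
    show "bij_betw (inv a) (range a) UNIV"
      using \<open>inj a\<close> by (simp add: bij_betw_inv_into inj_imp_bij_betw_inv)
    show "bij_betw ((`) (inv a)) Es' tail_hypergraph_edges"
      unfolding bij_betw_def
    proof
      have "inj_on (inv a) (range a)" by (rule inj_on_inv_into) simp
      then show "inj_on ((`) (inv a)) Es'"
        by (intro inj_on_subset[OF inj_on_image_Pow]) (auto simp: Es'_def)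
      show "(`) (inv a) ` Es' = tail_hypergraph_edges"
        by (simp add: Es'_def tail_hypergraph_edges_def image_image img)
    qed
  qed
  ultimately show ?thesis by blast
qed

text \<open>Finitely many tails share a vertex, so matchings have size at most 1. For covers the
  bound \<open>3 / 2\<close> is enough: two disjoint finite blocks of mass above
  \<open>3 / 4\<close> always exist.\<close>

lemma tail_hypergraph_duality_gap:
  assumes "hypergraph V Es" and iso: "hg_isomorphic V Es (UNIV :: nat set) tail_hypergraph_edges"
  shows "nu_star V Es < tau_star V Es"
proof -
  obtain \<phi> where \<phi>: "bij_betw \<phi> V (UNIV :: nat set)"
    and edges: "bij_betw ((`) \<phi>) Es tail_hypergraph_edges"
    using iso unfolding hg_isomorphic_def by blast
  have mem: "v \<in> E \<longleftrightarrow> \<phi> v \<in> \<phi> ` E" if "v \<in> V" "E \<in> Es" for v E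
    using inj_on_image_mem_iff[OF bij_betw_imp_inj_on[OF \<phi>]] that assms(1)
    by (auto simp: hypergraph_def)
  have nu: "nu_star V Es \<le> 1"
    unfolding nu_star_def
  proof (rule SUP_least, rule nnsum_least)
    fix f F assume f: "f \<in> {f. frac_matching V Es f}" and F: "finite F" "F \<subseteq> Es"
    have "\<phi> ` E \<in> range tail_edge" if "E \<in> F" for E
      using bij_betw_apply[OF edges] that F(2) by (auto simp: tail_hypergraph_edges_def)
    then have "\<exists>j. \<phi> ` E = tail_edge j" if "E \<in> F" for E
      using that by blast
    then obtain k where k: "\<And>E. E \<in> F \<Longrightarrow> \<phi> ` E = tail_edge (k E)" by metis
    obtain n where n: "\<And>E. E \<in> F \<Longrightarrow> k E \<le> n"
      using F(1) finite_nat_set_iff_bounded_le[of "k ` F"] by auto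
    obtain v where v: "v \<in> V" "\<phi> v = n"
      using bij_betw_imp_surj_on[OF \<phi>] by (metis UNIV_I imageE)
    have "v \<in> E" if "E \<in> F" for E
      using mem[OF v(1)] that F(2) k[OF that] n[OF that] v(2) by (auto simp: tail_edge_def)
    then have "ennreal (sum f F) \<le> nnsum f {E \<in> Es. v \<in> E}"
      using F by (intro nnsum_upper) auto
    also have "\<dots> \<le> 1" using f v(1) by (simp add: frac_matching_def)
    finally show "ennreal (sum f F) \<le> 1" .
  qed
  have "ennreal (3 / 2) \<le> tau_star V Es"
    unfolding tau_star_def
  proof (rule INF_greatest)
    fix g assume "g \<in> {g. frac_cover V Es g}"
    then have g: "\<And>E. E \<in> Es \<Longrightarrow> 1 \<le> nnsum g E"
      by (simp add: frac_cover_def)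
    \<comment> \<open>A tail starting beyond all of \<open>W\<close> is disjoint from it and still
      has to be covered.\<close>
    have next_block: "\<exists>W'. finite W' \<and> W' \<subseteq> V \<and> W \<inter> W' = {} \<and> 3 / 4 < sum g W'"
      if W: "finite W" "W \<subseteq> V" for W
    proof -
      obtain n where n: "\<And>v. v \<in> W \<Longrightarrow> \<phi> v < n"
        using W(1) finite_nat_set_iff_bounded[of "\<phi> ` W"] by auto
      obtain E where E: "E \<in> Es" "\<phi> ` E = tail_edge n"
        using bij_betw_imp_surj_on[OF edges]
        by (metis (no_types, lifting) imageE rangeI tail_hypergraph_edges_def)
      have "ennreal (3 / 4) < 1" by (simp add: ennreal_less_one_iff)
      also have "1 \<le> nnsum g E" by (rule g[OF E(1)])
      finally have "ennreal (3 / 4) < nnsum g E" .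
      then obtain W' where "finite W'" "W' \<subseteq> E" "3 / 4 < sum g W'"
        using less_nnsumD[of "3 / 4" g E] by auto
      moreover have "v \<notin> E" if "v \<in> W" for v
      proof
        assume "v \<in> E"
        then have "\<phi> v \<in> tail_edge n" unfolding E(2)[symmetric] by (rule imageI)
        then show False using n[OF that] by (simp add: tail_edge_def)
      qed
      moreover have "E \<subseteq> V" using E(1) assms(1) by (auto simp: hypergraph_def)
      ultimately show ?thesis by blast
    qed
    obtain W1 where W1: "finite W1" "W1 \<subseteq> V" "3 / 4 < sum g W1"
      using next_block[of "{}"] by auto
    obtain W2 where W2: "finite W2" "W2 \<subseteq> V" "W1 \<inter> W2 = {}" "3 / 4 < sum g W2"
      using next_block[OF W1(1,2)] by blast
    have "3 / 2 \<le> sum g (W1 \<union> W2)"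
      using W1 W2 by (simp add: sum.union_disjoint)
    then have "ennreal (3 / 2) \<le> ennreal (sum g (W1 \<union> W2))" by (rule ennreal_leI)
    also have "\<dots> \<le> nnsum g V" using W1 W2 by (intro nnsum_upper) auto
    finally show "ennreal (3 / 2) \<le> nnsum g V" .
  qed
  moreover have "1 < ennreal (3 / 2)" by (simp add: ennreal_1[symmetric] ennreal_less_iff del: ennreal_1)
  ultimately show ?thesis using nu by (meson le_less_trans less_le_trans)
qed

theorem theorem4p7:
  fixes V :: "'a set" and Es :: "'a set set"
  assumes "hypergraph V Es"
  shows "(\<forall>V' Es'. partial_sub_hypergraph V' Es' V Es \<longrightarrow>
            nu_star V' Es' = tau_star V' Es')
         \<longleftrightarrow>
         \<not> (\<exists>V' Es'. partial_sub_hypergraph V' Es' V Es \<and>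
              hg_isomorphic V' Es' (UNIV :: nat set) tail_hypergraph_edges)"
proof -
  have sub: "hypergraph V' Es'" if "partial_sub_hypergraph V' Es' V Es" for V' Es'
    using that by (auto simp: partial_sub_hypergraph_def hypergraph_def)
  show ?thesis
  proof
    assume "\<forall>V' Es'. partial_sub_hypergraph V' Es' V Es \<longrightarrow> nu_star V' Es' = tau_star V' Es'"
    then show "\<not> (\<exists>V' Es'. partial_sub_hypergraph V' Es' V Es \<and>
        hg_isomorphic V' Es' (UNIV :: nat set) tail_hypergraph_edges)"
      using sub tail_hypergraph_duality_gap by (metis less_irrefl)
  next
    assume no_tail: "\<not> (\<exists>V' Es'. partial_sub_hypergraph V' Es' V Es \<and>
        hg_isomorphic V' Es' (UNIV :: nat set) tail_hypergraph_edges)"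
    show "\<forall>V' Es'. partial_sub_hypergraph V' Es' V Es \<longrightarrow> nu_star V' Es' = tau_star V' Es'"
    proof (intro allI impI)
      fix V' Es' assume H': "partial_sub_hypergraph V' Es' V Es"
      \<comment> \<open>A tail in the sub-hypergraph lifts to one in the whole hypergraph, where it
        is excluded.\<close>
      have "\<not> has_tail V' Es'"
        using no_tail has_tail_imp_tail_hypergraph has_tail_partial_sub_hypergraph[OF H'] by blast
      then have "\<not> nu_star V' Es' < tau_star V' Es'"
        using nu_star_less_tau_star_imp_has_tail by blast
      then show "nu_star V' Es' = tau_star V' Es'"
        using nu_star_le_tau_star[OF sub[OF H']] by (simp add: less_le)
    qed
  qed
qed

end
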